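(* There exist a two-dimensional complex Hilbert space $H$, operators $A,B,C,D,E,F\in B(H)$ and a sesquilinear form $u:H\times H\to\mathbb{C}$ such that $$|u(x,y)|\le \|Ax\|\,\|By\|+\|Cx\|\,\|Dy\|+\|Ex\|\,\|Fy\|\quad\text{for all }x,y\in H,$$ but there do not exist sesquilinear forms $u_1,u_2,u_3:H\times H\to\mathbb{C}$ with $u=u_1+u_2+u_3$ and $$|u_1(x,y)|\le \|Ax\|\,\|By\|,\qquad |u_2(x,y)|\le \|Cx\|\,\|Dy\|,\qquad |u_3(x,y)|\le \|Ex\|\,\|Fy\|\quad\text{for all }x,y\in H.$$
   Context: $B(H)$ is the space of (bounded) linear operators on $H$. A sesquilinear form is linear in the first variable and conjugate linear in the second. *)

theory Defs
  imports "HOL-Analysis.Analysis"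
begin

text \<open>
  HOL-Analysis only has real inner product spaces, so complex Hilbert spaces are
  introduced here as a scalar multiplication \<open>sc\<close> and a complex inner product \<open>ip\<close> on the
  underlying abelian group of a type. No type-class topology or norm is used.
\<close>

definition sesquilinear_form ::
    "(complex \<Rightarrow> 'a::ab_group_add \<Rightarrow> 'a) \<Rightarrow> ('a \<Rightarrow> 'a \<Rightarrow> complex) \<Rightarrow> bool" where
  "sesquilinear_form sc u \<longleftrightarrow>
     (\<forall>x x' y. u (x + x') y = u x y + u x' y) \<and>
     (\<forall>c x y. u (sc c x) y = c * u x y) \<and>
     (\<forall>x y y'. u x (y + y') = u x y + u x y') \<and>
     (\<forall>c x y. u x (sc c y) = cnj c * u x y)"

definition ip_norm :: "('a \<Rightarrow> 'a \<Rightarrow> complex) \<Rightarrow> 'a \<Rightarrow> real" where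
  "ip_norm ip x = sqrt (Re (ip x x))"

locale complex_hilbert_space = vector_space sc
  for sc :: "complex \<Rightarrow> 'a::ab_group_add \<Rightarrow> 'a" +
  fixes ip :: "'a \<Rightarrow> 'a \<Rightarrow> complex"
  assumes ip_sesquilinear: "sesquilinear_form sc ip"
    and ip_hermitian: "ip x y = cnj (ip y x)"
    and ip_positive: "x \<noteq> 0 \<Longrightarrow> Re (ip x x) > 0"
    and ip_complete: "Metric_space.mcomplete UNIV (\<lambda>x y. ip_norm ip (x - y))"

definition bounded_operators ::
    "(complex \<Rightarrow> 'a::ab_group_add \<Rightarrow> 'a) \<Rightarrow> ('a \<Rightarrow> 'a \<Rightarrow> complex) \<Rightarrow> ('a \<Rightarrow> 'a) set" where
  "bounded_operators sc ip =
     {T. Vector_Spaces.linear sc sc T \<and> (\<exists>K. \<forall>x. ip_norm ip (T x) \<le> K * ip_norm ip x)}"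

end

(* Take u(x,y) = x1 * cnj y2 and A = B, C = D, E = F mapping x to x1 e1, x2 e1 and
   (x1 + x2) e1. A form dominated by |f x| |f y| for a linear functional f with real
   coefficients is a multiple of f x * cnj (f y), hence takes equal values at (e1, e2) and
   (e2, e1); so does every sum of three such forms, whereas u does not. *)

theory Submission
  imports Defs
begin

definition vip :: "complex^'n \<Rightarrow> complex^'n \<Rightarrow> complex" where
  "vip x y = (\<Sum>i\<in>UNIV. x $ i * cnj (y $ i))"

text \<open>Bridge to the library norm on \<open>complex^'n\<close>: positivity, completeness and
  boundedness of matrix operators can then be taken from the known facts about \<open>norm\<close>
  and \<open>dist\<close>.\<close>

lemma ip_norm_vip: "ip_norm vip x = norm x"
proof -
  have "Re (vip x x) = (\<Sum>i\<in>UNIV. (norm (x $ i))\<^sup>2)"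
    by (simp add: vip_def complex_norm_square[symmetric])
  then show ?thesis
    by (simp add: ip_norm_def norm_vec_def L2_set_def)
qed

lemma sesquilinear_vip: "sesquilinear_form (*s) vip"
  by (simp add: sesquilinear_form_def vip_def algebra_simps sum.distrib sum_distrib_left)

lemma complex_hilbert_space_vip:
  "complex_hilbert_space ((*s) :: complex \<Rightarrow> complex^'n \<Rightarrow> _) vip"
proof (intro complex_hilbert_space.intro complex_hilbert_space_axioms.intro)
  show "vector_space ((*s) :: complex \<Rightarrow> complex^'n \<Rightarrow> _)"
    by (rule vec.vector_space_axioms)
  show "sesquilinear_form (*s) (vip :: complex^'n \<Rightarrow> _)"
    by (rule sesquilinear_vip)
  show "vip x y = cnj (vip y x)" for x y :: "complex^'n"
    by (simp add: vip_def mult.commute)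
  show "Re (vip x x) > 0" if "x \<noteq> 0" for x :: "complex^'n"
    using that ip_norm_vip[of x] by (simp add: ip_norm_def) (metis real_sqrt_gt_0_iff zero_less_norm_iff)
  have "(\<lambda>x y. ip_norm vip (x - y)) = (dist :: complex^'n \<Rightarrow> _)"
    by (simp add: fun_eq_iff ip_norm_vip dist_norm)
  then show "Metric_space.mcomplete UNIV (\<lambda>x y :: complex^'n. ip_norm vip (x - y))"
    using mcomplete_iff_complete complete_UNIV by metis
qed

lemma matrix_vector_mult_bounded_operator:
  fixes M :: "complex^'n^'n"
  shows "(*v) M \<in> bounded_operators (*s) vip"
proof -
  obtain K where "\<And>x. norm (M *v x) \<le> norm x * K"
    using bounded_linear.bounded[OF matrix_vector_mul_bounded_linear] by blast
  then show ?thesis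
    by (auto simp: bounded_operators_def ip_norm_vip mult.commute matrix_vector_mul_linear_gen)
qed

text \<open>The functional with coefficients \<open>a\<close>, \<open>b\<close>, turned into an
  operator on the plane by placing its value in the first coordinate. The zero second row makes the
  norm of the image equal to the modulus of the functional.\<close>

definition functional_op :: "complex \<Rightarrow> complex \<Rightarrow> complex^2 \<Rightarrow> complex^2" where
  "functional_op a b = (*v) (vector [vector [a, b], 0])"

lemma ip_norm_functional_op: "ip_norm vip (functional_op a b x) = cmod (a * x $ 1 + b * x $ 2)"
  by (simp add: ip_norm_vip functional_op_def norm_vec_def L2_set_def sum_2
      matrix_vector_mult_def)

lemma functional_op_bounded: "functional_op a b \<in> bounded_operators (*s) vip"
  unfolding functional_op_def by (rule matrix_vector_mult_bounded_operator)

text \<open>If \<open>p\<close> is no larger than \<open>q\<close> in modulus, or \<open>s\<close>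
  no larger than \<open>r\<close>, one of the first two products already dominates. Otherwise
  reverse triangle inequalities bound the third product from below, and expanding gives the claim
  with \<open>cmod q * cmod r\<close> to spare.\<close>

lemma cross_product_bound:
  fixes p q r s :: complex
  shows "cmod (p * s) \<le> cmod p * cmod r + cmod q * cmod s + cmod (p + q) * cmod (r + s)"
proof (cases "cmod p \<le> cmod q \<or> cmod s \<le> cmod r")
  case True
  then have "cmod p * cmod s \<le> cmod p * cmod r \<or> cmod p * cmod s \<le> cmod q * cmod s"
    by (auto intro: mult_left_mono mult_right_mono)
  moreover have "0 \<le> cmod p * cmod r" "0 \<le> cmod q * cmod s" "0 \<le> cmod (p + q) * cmod (r + s)"
    by simp_all
  ultimately show ?thesis
    unfolding norm_mult by linarith
next
  case False
  \<comment> \<open>Both differences are positive in this case, so the two reverse triangle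
    inequalities can be multiplied.\<close>
  have "(cmod p - cmod q) * (cmod s - cmod r) \<le> cmod (p + q) * cmod (r + s)"
    using False norm_diff_ineq[of p q] norm_diff_ineq[of s r]
    by (intro mult_mono) (auto simp: add.commute)
  moreover have "0 \<le> cmod q * cmod r" by simp
  ultimately show ?thesis
    unfolding norm_mult left_diff_distrib right_diff_distrib by linarith
qed

theorem mainTheorem2:
  "\<exists>(sc :: complex \<Rightarrow> complex^2 \<Rightarrow> complex^2) (ip :: complex^2 \<Rightarrow> complex^2 \<Rightarrow> complex).
     complex_hilbert_space sc ip \<and> vector_space.dim sc UNIV = 2 \<and>
     (\<exists>A \<in> bounded_operators sc ip. \<exists>B \<in> bounded_operators sc ip.
      \<exists>C \<in> bounded_operators sc ip. \<exists>D \<in> bounded_operators sc ip.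
      \<exists>E \<in> bounded_operators sc ip. \<exists>F \<in> bounded_operators sc ip.
      \<exists>u. sesquilinear_form sc u \<and>
        (\<forall>x y. cmod (u x y) \<le> ip_norm ip (A x) * ip_norm ip (B y)
                            + ip_norm ip (C x) * ip_norm ip (D y)
                            + ip_norm ip (E x) * ip_norm ip (F y)) \<and>
        \<not> (\<exists>u1 u2 u3. sesquilinear_form sc u1 \<and> sesquilinear_form sc u2 \<and> sesquilinear_form sc u3 \<and>
             (\<forall>x y. u x y = u1 x y + u2 x y + u3 x y) \<and>
             (\<forall>x y. cmod (u1 x y) \<le> ip_norm ip (A x) * ip_norm ip (B y)) \<and>
             (\<forall>x y. cmod (u2 x y) \<le> ip_norm ip (C x) * ip_norm ip (D y)) \<and>
             (\<forall>x y. cmod (u3 x y) \<le> ip_norm ip (E x) * ip_norm ip (F y))))"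
proof -
  let ?A = "functional_op 1 0" and ?C = "functional_op 0 1" and ?E = "functional_op 1 1"
  let ?e1 = "axis 1 1 :: complex^2" and ?e2 = "axis 2 1 :: complex^2"
  define u :: "complex^2 \<Rightarrow> complex^2 \<Rightarrow> complex" where "u x y = x $ 1 * cnj (y $ 2)" for x y
  have u: "sesquilinear_form (*s) u"
    by (simp add: sesquilinear_form_def u_def algebra_simps)
  have bound: "cmod (u x y) \<le> ip_norm vip (?A x) * ip_norm vip (?A y)
      + ip_norm vip (?C x) * ip_norm vip (?C y) + ip_norm vip (?E x) * ip_norm vip (?E y)" for x y
    \<comment> \<open>The instances are listed in the order of occurrence \<open>p\<close>,
      \<open>s\<close>, \<open>r\<close>, \<open>q\<close>: the pair \<open>p\<close>,
      \<open>q\<close> comes from \<open>x\<close>, the pair \<open>r\<close>, \<open>s\<close> from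
      the conjugate of \<open>y\<close>.\<close>
    using cross_product_bound[of "x $ 1" "cnj (y $ 2)" "cnj (y $ 1)" "x $ 2"]
    by (simp add: ip_norm_functional_op u_def flip: complex_cnj_add)
  have no_decomposition: False
    if s: "sesquilinear_form (*s) u1" "sesquilinear_form (*s) u2" "sesquilinear_form (*s) u3"
      and sum: "\<And>x y. u x y = u1 x y + u2 x y + u3 x y"
      and b1: "\<And>x y. cmod (u1 x y) \<le> ip_norm vip (?A x) * ip_norm vip (?A y)"
      and b2: "\<And>x y. cmod (u2 x y) \<le> ip_norm vip (?C x) * ip_norm vip (?C y)"
      and b3: "\<And>x y. cmod (u3 x y) \<le> ip_norm vip (?E x) * ip_norm vip (?E y)"
    for u1 u2 u3 :: "complex^2 \<Rightarrow> complex^2 \<Rightarrow> complex"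
  proof -
    \<comment> \<open>\<open>?A\<close> kills \<open>?e2\<close> and \<open>?C\<close> kills
      \<open>?e1\<close>, so each of these bounds has a zero factor.\<close>
    have off_diagonal: "u1 ?e1 ?e2 = 0" "u1 ?e2 ?e1 = 0" "u2 ?e1 ?e2 = 0" "u2 ?e2 ?e1 = 0"
      using b1[of ?e1 ?e2] b1[of ?e2 ?e1] b2[of ?e1 ?e2] b2[of ?e2 ?e1]
      by (simp_all add: ip_norm_functional_op axis_def)
    \<comment> \<open>The difference of the basis vectors lies in the kernel of \<open>?E\<close>,
      so \<open>u3\<close> vanishes as soon as one argument is this vector. Expanding in that
      argument shows that both off-diagonal values of \<open>u3\<close> equal
      \<open>u3 ?e2 ?e2\<close>.\<close>
    have "u3 (?e1 + (-1) *s ?e2) ?e2 = 0" "u3 ?e2 (?e1 + (-1) *s ?e2) = 0"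
      using b3[of "?e1 + (-1) *s ?e2" ?e2] b3[of ?e2 "?e1 + (-1) *s ?e2"]
      by (simp_all add: ip_norm_functional_op axis_def)
    moreover have "u3 (?e1 + (-1) *s ?e2) ?e2 = u3 ?e1 ?e2 + (-1) * u3 ?e2 ?e2"
      "u3 ?e2 (?e1 + (-1) *s ?e2) = u3 ?e2 ?e1 + cnj (-1) * u3 ?e2 ?e2"
      using s(3) unfolding sesquilinear_form_def by metis+
    ultimately have "u3 ?e1 ?e2 = u3 ?e2 ?e1" by simp
    then have "u ?e1 ?e2 = u ?e2 ?e1" by (simp add: sum off_diagonal)
    \<comment> \<open>The two values of \<open>u\<close> are 1 and 0.\<close>
    then show False by (simp add: u_def axis_def)
  qed
  have dim: "vec.dim (UNIV :: (complex^2) set) = 2"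
    by (subst vec_dim_card) simp
  show ?thesis
  proof (intro exI[of _ "(*s)"] exI[of _ vip] conjI complex_hilbert_space_vip dim)
    show "\<exists>A\<in>bounded_operators (*s) vip. \<exists>B\<in>bounded_operators (*s) vip.
      \<exists>C\<in>bounded_operators (*s) vip. \<exists>D\<in>bounded_operators (*s) vip.
      \<exists>E\<in>bounded_operators (*s) vip. \<exists>F\<in>bounded_operators (*s) vip.
      \<exists>u :: complex^2 \<Rightarrow> complex^2 \<Rightarrow> complex. sesquilinear_form (*s) u \<and>
        (\<forall>x y. cmod (u x y) \<le> ip_norm vip (A x) * ip_norm vip (B y)
                            + ip_norm vip (C x) * ip_norm vip (D y)
                            + ip_norm vip (E x) * ip_norm vip (F y)) \<and>
        \<not> (\<exists>u1 u2 u3. sesquilinear_form (*s) u1 \<and> sesquilinear_form (*s) u2 \<and> sesquilinear_form (*s) u3 \<and>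
             (\<forall>x y. u x y = u1 x y + u2 x y + u3 x y) \<and>
             (\<forall>x y. cmod (u1 x y) \<le> ip_norm vip (A x) * ip_norm vip (B y)) \<and>
             (\<forall>x y. cmod (u2 x y) \<le> ip_norm vip (C x) * ip_norm vip (D y)) \<and>
             (\<forall>x y. cmod (u3 x y) \<le> ip_norm vip (E x) * ip_norm vip (F y)))"
      by (rule bexI[of _ ?A], rule bexI[of _ ?A], rule bexI[of _ ?C],
          rule bexI[of _ ?C], rule bexI[of _ ?E], rule bexI[of _ ?E], rule exI[of _ u])
        (use u bound no_decomposition in blast, (rule functional_op_bounded)+)
  qed
qed

end
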